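(* Let $f:\mathbb{R}^n\to\mathbb{R}$ be convex and differentiable with $\|\nabla f(x)-\nabla f(y)\|\le L\|x-y\|$ for all $x,y\in\mathbb{R}^n$, where $L>0$, and let $f$ have a minimizer $x_*$. Let $D\subset\mathbb{R}^n$ be a finite set of unit-norm vectors forming a positive spanning set, with cosine measure $\mu$. Let $x_0\in\mathbb{R}^n$, $\alpha_0>0$, $c>0$ be such that $$R_0=\sup_{x\in\mathbb{R}^n}\{\|x-x_*\| : f(x)\le f(x_0)\}<\infty$$ and $$f(x_0+\alpha_0 d)>f(x_0)-c\alpha_0^2\quad\text{for all } d\in D.$$ Put $B=\frac{R_0(\frac L2+c)}{\mu}$. Then: (i) The iterates $\{x_k\}_{k\ge0}$ of Simplified Direct Search (SDS) with input $(x_0,\alpha_0,c,D)$ satisfy $$\|\nabla f(x_k)\|\le\frac{(\frac L2+c)\alpha_0}{\mu2^k},\qquad f(x_k)-f(x_* )\le\frac{B\alpha_0}{2^k},\qquad k\ge0,$$ where at iteration $k$ ($k\geq 1$) the method needs to perform at most $|D|\left(1+\frac{2^{k+1}B}{c\alpha_0}\right)$ function evaluations. (ii) In particular, if $0<\epsilon\le B\alpha_0$ and $k=k(\epsilon)=\left\lceil\log_2\left(\frac{B\alpha_0}{\epsilon}\right)\right\rceil$, then $f(x_k)-f(x_* )\le\epsilon$, while SDS performs, up to iteration $k(\epsilon)$, in total at most $N(k(\epsilon))$ function evaluations, where $$N(k(\epsilon))\le1+|D|\left(k(\epsilon)+\frac{8B^2}{c\epsilon}\right).$$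
   Context: $\langle\cdot,\cdot\rangle$ and $\|\cdot\|$ are the standard Euclidean inner product and norm on $\mathbb{R}^n$. A finite set $D\subset\mathbb{R}^n$ is a positive spanning set if its conic hull $\{\sum_i t_i d_i: d_i\in D,\ t_i\ge 0\}$ equals $\mathbb{R}^n$. The cosine measure of $D$ is $\mu=\min_{0\ne v\in\mathbb{R}^n}\max_{d\in D}\frac{\langle v,d\rangle}{\|v\|\|d\|}$; it is positive for a positive spanning set of nonzero vectors. Simplified Direct Search (SDS). Input: $x_0\in\mathbb{R}^n$, $\alpha_0>0$, forcing constant $c>0$, finite set $D\subset\mathbb{R}^n$. For $k=1,2,\dots$: set $x_k^0=x_{k-1}$ and $\alpha_k=\frac12\alpha_{k-1}$ (so $\alpha_k=\alpha_0/2^k$); starting from $l=0$, while there exists $d\in D$ with $f(x_k^l+\alpha_k d)\le f(x_k^l)-c\alpha_k^2$, pick any such $d$, call it $d_k^l$, set $x_k^{l+1}=x_k^l+\alpha_k d_k^l$ and increase $l$ by one. Let $l_k$ be the value of $l$ when this inner loop stops (i.e. $f(x_k^{l_k}+\alpha_k d)>f(x_k^{l_k})-c\alpha_k^2$ for all $d\in D$), and set $x_k=x_k^{l_k}$. The choice of $d$ among those satisfying the decrease condition is arbitrary, and the statement holds for every such choice. Cost model: computing $f(x_0)$ costs one evaluation; given the value of $f$ at the current point, finding a direction satisfying the decrease condition, or verifying that there is none, costs at most $|D|$ evaluations. Thus iteration $j$ costs at most $|D|(l_j+1)$ evaluations, and the total up to iteration $k$ is at most $N(k)=1+\sum_{j=1}^k|D|(l_j+1)$.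 The per-iteration bound in (i) is a bound on $|D|(l_k+1)$. *)

theory Defs
  imports "HOL-Analysis.Analysis"
begin

definition positive_spanning_set :: "'a::real_vector set \<Rightarrow> bool" where
  "positive_spanning_set D \<longleftrightarrow>
     finite D \<and> {\<Sum>d\<in>D. t d *\<^sub>R d | t. \<forall>d\<in>D. 0 \<le> t d} = UNIV"

text \<open>The outer minimum is over an infinite set, so it is written as an infimum.  For a finite
  nonempty set of nonzero vectors it is attained, the quotient being homogeneous of degree 0 and
  continuous in \<open>v\<close> on the unit sphere.\<close>

definition cosine_measure :: "'a::euclidean_space set \<Rightarrow> real" where
  "cosine_measure D = (INF v\<in>-{0}. Max ((\<lambda>d. (v \<bullet> d) / (norm v * norm d)) ` D))"

definition sufficient_decrease :: "('a::real_vector \<Rightarrow> real) \<Rightarrow> real \<Rightarrow> real \<Rightarrow> 'a \<Rightarrow> 'a \<Rightarrow> bool" where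
  "sufficient_decrease f c \<alpha> x d \<longleftrightarrow> f (x + \<alpha> *\<^sub>R d) \<le> f x - c * \<alpha>\<^sup>2"

definition poll_fails :: "('a::real_vector \<Rightarrow> real) \<Rightarrow> 'a set \<Rightarrow> real \<Rightarrow> real \<Rightarrow> 'a \<Rightarrow> bool" where
  "poll_fails f D c \<alpha> x \<longleftrightarrow> (\<forall>d\<in>D. \<not> sufficient_decrease f c \<alpha> x d)"

primrec sds_stepsize :: "real \<Rightarrow> nat \<Rightarrow> real" where
  "sds_stepsize \<alpha>0 0 = \<alpha>0"
| "sds_stepsize \<alpha>0 (Suc k) = sds_stepsize \<alpha>0 k / 2"

text \<open>In the following, \<open>X k l\<close> is the \<open>l\<close>-th inner point of iteration \<open>k\<close>.\<close>

definition sds_inner_stops ::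
  "('a::real_vector \<Rightarrow> real) \<Rightarrow> 'a set \<Rightarrow> real \<Rightarrow> real \<Rightarrow> (nat \<Rightarrow> nat \<Rightarrow> 'a) \<Rightarrow> nat \<Rightarrow> bool" where
  "sds_inner_stops f D \<alpha>0 c X k \<longleftrightarrow> (\<exists>l. poll_fails f D c (sds_stepsize \<alpha>0 k) (X k l))"

text \<open>The number of successful steps of iteration \<open>k\<close>; meaningful only if the inner loop of
  iteration \<open>k\<close> stops.\<close>

definition sds_steps ::
  "('a::real_vector \<Rightarrow> real) \<Rightarrow> 'a set \<Rightarrow> real \<Rightarrow> real \<Rightarrow> (nat \<Rightarrow> nat \<Rightarrow> 'a) \<Rightarrow> nat \<Rightarrow> nat" where
  "sds_steps f D \<alpha>0 c X k = (LEAST l. poll_fails f D c (sds_stepsize \<alpha>0 k) (X k l))"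

text \<open>\<open>x\<close>, \<open>X\<close>, \<open>d\<close> are the outer iterates, the inner points and the chosen directions of some
  execution of Simplified Direct Search, with arbitrary choices among the directions of sufficient
  decrease.  Step \<open>l\<close> of the inner loop is carried out iff no poll failed at the inner points
  \<open>0, \<dots>, l\<close>; the values of \<open>X k\<close> and \<open>d k\<close> beyond the first failed poll are unconstrained.
  Termination of the inner loops is not built in: if one of them ran forever, the subsequent
  outer iterates would have no algorithmic meaning.\<close>

definition sds_execution ::
  "('a::real_vector \<Rightarrow> real) \<Rightarrow> 'a set \<Rightarrow> 'a \<Rightarrow> real \<Rightarrow> real \<Rightarrow>
   (nat \<Rightarrow> 'a) \<Rightarrow> (nat \<Rightarrow> nat \<Rightarrow> 'a) \<Rightarrow> (nat \<Rightarrow> nat \<Rightarrow> 'a) \<Rightarrow> bool" where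
  "sds_execution f D x0 \<alpha>0 c x X d \<longleftrightarrow>
     x 0 = x0 \<and>
     (\<forall>k\<ge>1.
        X k 0 = x (k - 1) \<and>
        (\<forall>l. (\<forall>i\<le>l. \<not> poll_fails f D c (sds_stepsize \<alpha>0 k) (X k i)) \<longrightarrow>
             d k l \<in> D \<and>
             sufficient_decrease f c (sds_stepsize \<alpha>0 k) (X k l) (d k l) \<and>
             X k (Suc l) = X k l + sds_stepsize \<alpha>0 k *\<^sub>R d k l) \<and>
        x k = X k (sds_steps f D \<alpha>0 c X k))"

text \<open>Cost model: \<open>q k l\<close> is the number of function evaluations spent at the \<open>l\<close>-th inner point
  of iteration \<open>k\<close> on finding a direction of sufficient decrease or verifying that there is none.
  An iteration with \<open>m\<close> successful steps polls at \<open>m + 1\<close> points.\<close>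

definition sds_poll_costs ::
  "('a::real_vector \<Rightarrow> real) \<Rightarrow> 'a set \<Rightarrow> real \<Rightarrow> real \<Rightarrow> (nat \<Rightarrow> nat \<Rightarrow> 'a) \<Rightarrow>
   (nat \<Rightarrow> nat \<Rightarrow> nat) \<Rightarrow> bool" where
  "sds_poll_costs f D \<alpha>0 c X q \<longleftrightarrow>
     (\<forall>k\<ge>1. \<forall>l\<le>sds_steps f D \<alpha>0 c X k. q k l \<le> card D)"

definition sds_iteration_evals ::
  "('a::real_vector \<Rightarrow> real) \<Rightarrow> 'a set \<Rightarrow> real \<Rightarrow> real \<Rightarrow> (nat \<Rightarrow> nat \<Rightarrow> 'a) \<Rightarrow>
   (nat \<Rightarrow> nat \<Rightarrow> nat) \<Rightarrow> nat \<Rightarrow> nat" where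
  "sds_iteration_evals f D \<alpha>0 c X q k = (\<Sum>l\<le>sds_steps f D \<alpha>0 c X k. q k l)"

text \<open>The leading \<open>1\<close> here and in \<open>sds_N\<close> is the evaluation of \<open>f\<close> at the starting point.\<close>

definition sds_total_evals ::
  "('a::real_vector \<Rightarrow> real) \<Rightarrow> 'a set \<Rightarrow> real \<Rightarrow> real \<Rightarrow> (nat \<Rightarrow> nat \<Rightarrow> 'a) \<Rightarrow>
   (nat \<Rightarrow> nat \<Rightarrow> nat) \<Rightarrow> nat \<Rightarrow> nat" where
  "sds_total_evals f D \<alpha>0 c X q k = 1 + (\<Sum>j=1..k. sds_iteration_evals f D \<alpha>0 c X q j)"

definition sds_N ::
  "('a::real_vector \<Rightarrow> real) \<Rightarrow> 'a set \<Rightarrow> real \<Rightarrow> real \<Rightarrow> (nat \<Rightarrow> nat \<Rightarrow> 'a) \<Rightarrow> nat \<Rightarrow> nat" where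
  "sds_N f D \<alpha>0 c X k = 1 + (\<Sum>j=1..k. card D * (sds_steps f D \<alpha>0 c X j + 1))"

end

(* Where polling fails with step size a, some direction d in D makes an angle of cosine at least \<mu> with
   minus the gradient, and the descent lemma along d turns the failed decrease into
   norm (grad) < (L/2 + c) a / \<mu>; convexity and the bounded level set convert this into a bound on the
   optimality gap.  Every successful step of iteration k decreases f by at least c * (\<alpha>0 / 2^k)^2, and the
   gap available at its start is at most B * \<alpha>0 / 2^(k-1); so the number of steps is at most the quotient,
   and these bounds form a geometric sum. *)
theory Submission
  imports Defs
begin

section \<open>Positive spanning sets and the cosine measure\<close>

lemma positive_spanning_setE:
  assumes "positive_spanning_set D"
  obtains t where "v = (\<Sum>d\<in>D. t d *\<^sub>R d)" "\<And>d. d \<in> D \<Longrightarrow> 0 \<le> t d"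
proof -
  have "v \<in> {\<Sum>d\<in>D. t d *\<^sub>R d | t. \<forall>d\<in>D. 0 \<le> t d}"
    using assms unfolding positive_spanning_set_def by simp
  then show ?thesis
    using that by blast
qed

lemma positive_spanning_set_nonempty:
  fixes D :: "'a::euclidean_space set"
  assumes "positive_spanning_set D"
  shows "D \<noteq> {}"
proof
  assume "D = {}"
  obtain b :: 'a where "b \<in> Basis"
    using nonempty_Basis by blast
  moreover obtain t where "b = (\<Sum>d\<in>D. t d *\<^sub>R d)"
    using positive_spanning_setE[OF assms] by metis
  ultimately show False
    using \<open>D = {}\<close> by simp
qed

text \<open>Expand only the right factor of \<open>v \<bullet> v\<close> in a nonnegative
  combination of \<open>D\<close>: if no \<open>d\<close> made a positive inner product with
  \<open>v\<close>, the square would be at most 0.\<close>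

lemma positive_spanning_set_inner_pos:
  fixes D :: "'a::real_inner set"
  assumes "positive_spanning_set D" "v \<noteq> 0"
  obtains d where "d \<in> D" "v \<bullet> d > 0"
proof -
  obtain t where v: "v = (\<Sum>d\<in>D. t d *\<^sub>R d)" and t: "\<And>d. d \<in> D \<Longrightarrow> 0 \<le> t d"
    using positive_spanning_setE[OF assms(1)] by metis
  have "v \<bullet> v = (\<Sum>d\<in>D. t d * (v \<bullet> d))"
    by (subst (2) v) (simp add: inner_sum_right)
  moreover have "(\<Sum>d\<in>D. t d * (v \<bullet> d)) \<le> 0" if "\<And>d. d \<in> D \<Longrightarrow> v \<bullet> d \<le> 0"
    by (intro sum_nonpos mult_nonneg_nonpos t that)
  ultimately show ?thesis
    using that \<open>v \<noteq> 0\<close> by (metis inner_gt_zero_iff not_less)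
qed

(* The constant is 1 / (T + 1), T the total weight needed to represent all vectors b and - b, b in Basis. *)
lemma positive_spanning_set_inner_lower_bound:
  fixes D :: "'a::euclidean_space set"
  assumes "positive_spanning_set D"
  shows "\<exists>\<kappa>>0. \<forall>v. v \<noteq> 0 \<longrightarrow> (\<exists>d\<in>D. \<kappa> * norm v \<le> v \<bullet> d)"
proof -
  have fin: "finite D"
    using assms by (simp add: positive_spanning_set_def)
  have "\<exists>t. w = (\<Sum>d\<in>D. t d *\<^sub>R d) \<and> (\<forall>d\<in>D. 0 \<le> t d)" for w :: 'a
    using positive_spanning_setE[OF assms] by metis
  then obtain t :: "'a \<Rightarrow> 'a \<Rightarrow> real"
    where t: "\<And>w. w = (\<Sum>d\<in>D. t w d *\<^sub>R d)" and t_nonneg: "\<And>w d. d \<in> D \<Longrightarrow> 0 \<le> t w d"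
    by metis
  define T where "T = (\<Sum>b\<in>Basis. (\<Sum>d\<in>D. t b d) + (\<Sum>d\<in>D. t (- b) d))"
  have T_nonneg: "T \<ge> 0"
    unfolding T_def by (intro sum_nonneg add_nonneg_nonneg t_nonneg)
  show ?thesis
  proof (intro exI[of _ "1 / (T + 1)"] conjI allI impI)
    show "1 / (T + 1) > 0"
      using T_nonneg by simp
    fix v :: 'a
    assume "v \<noteq> 0"
    then obtain d0 where d0: "d0 \<in> D" "v \<bullet> d0 > 0"
      using positive_spanning_set_inner_pos[OF assms] by metis
    define M where "M = Max ((\<lambda>d. v \<bullet> d) ` D)"
    have le_M: "v \<bullet> d \<le> M" if "d \<in> D" for d
      unfolding M_def using fin that by auto
    have M_nonneg: "M \<ge> 0"
      using le_M[OF d0(1)] d0(2) by linarith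
    obtain d where d: "d \<in> D" "v \<bullet> d = M"
    proof -
      have "M \<in> (\<lambda>d. v \<bullet> d) ` D"
        unfolding M_def using fin d0(1) by (intro Max_in) auto
      then show ?thesis
        using that by auto
    qed
    \<comment> \<open>The weights are nonnegative, so each \<open>v \<bullet> d\<close> may be
      replaced by the maximum \<open>M\<close>.\<close>
    have inner_le: "v \<bullet> w \<le> (\<Sum>d\<in>D. t w d) * M" for w
    proof -
      have "v \<bullet> w = (\<Sum>d\<in>D. t w d * (v \<bullet> d))"
        by (subst t[of w]) (simp add: inner_sum_right)
      also have "\<dots> \<le> (\<Sum>d\<in>D. t w d * M)"
        by (intro sum_mono mult_left_mono le_M t_nonneg)
      finally show ?thesis
        by (simp add: sum_distrib_right)
    qed
    have "\<bar>v \<bullet> b\<bar> \<le> ((\<Sum>d\<in>D. t b d) + (\<Sum>d\<in>D. t (- b) d)) * M" for b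
    proof -
      have "0 \<le> (\<Sum>d\<in>D. t b d) * M" "0 \<le> (\<Sum>d\<in>D. t (- b) d) * M"
        by (intro mult_nonneg_nonneg sum_nonneg t_nonneg M_nonneg; assumption)+
      then show ?thesis
        using inner_le[of b] inner_le[of "- b"] by (simp add: abs_if distrib_right)
    qed
    then have "(\<Sum>b\<in>Basis. \<bar>v \<bullet> b\<bar>) \<le> T * M"
      unfolding T_def sum_distrib_right by (intro sum_mono)
    \<comment> \<open>Passing from \<open>T\<close> to \<open>T + 1\<close> gives a positive
      denominator from \<open>T \<ge> 0\<close> alone.\<close>
    then have "norm v \<le> (T + 1) * M"
      using norm_le_l1[of v] M_nonneg by (simp add: distrib_right)
    then have "1 / (T + 1) * norm v \<le> v \<bullet> d"
      using d(2) T_nonneg by (simp add: field_simps)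
    then show "\<exists>d\<in>D. 1 / (T + 1) * norm v \<le> v \<bullet> d"
      using d(1) by blast
  qed
qed

text \<open>Attainment of the infimum is avoided. The uniform constant \<open>\<kappa>\<close>
  bounds all the maxima from below, which makes the infimum positive and also supplies the
  boundedness needed to compare it with a single value \<open>F v\<close>.\<close>

lemma cosine_measure_unit_pos:
  fixes D :: "'a::euclidean_space set"
  assumes span: "positive_spanning_set D" and unit: "\<And>d. d \<in> D \<Longrightarrow> norm d = 1"
  shows "cosine_measure D > 0"
    and "\<exists>d\<in>D. cosine_measure D * norm v \<le> v \<bullet> d"
proof -
  define F where "F v = Max ((\<lambda>d. (v \<bullet> d) / (norm v * norm d)) ` D)" for v :: 'a
  have fin: "finite D" and ne: "D \<noteq> {}"
    using span positive_spanning_set_nonempty by (auto simp: positive_spanning_set_def)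
  obtain \<kappa> where \<kappa>: "\<kappa> > 0" "\<And>v. v \<noteq> 0 \<Longrightarrow> \<exists>d\<in>D. \<kappa> * norm v \<le> v \<bullet> d"
    using positive_spanning_set_inner_lower_bound[OF span] by blast
  have \<kappa>_le: "\<kappa> \<le> F v" if nz: "v \<noteq> 0" for v
  proof -
    obtain d where d: "d \<in> D" "\<kappa> * norm v \<le> v \<bullet> d"
      using \<kappa>(2)[OF nz] by blast
    then have "\<kappa> \<le> (v \<bullet> d) / (norm v * norm d)"
      using nz unit[OF d(1)] by (simp add: pos_le_divide_eq)
    also have "\<dots> \<le> F v"
      unfolding F_def using fin d(1) by (intro Max_ge) auto
    finally show ?thesis .
  qed
  obtain b :: 'a where "b \<noteq> 0"
    using nonempty_Basis nonzero_Basis by blast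
  then have "\<kappa> \<le> cosine_measure D"
    unfolding cosine_measure_def F_def[symmetric] by (intro cINF_greatest) (auto intro: \<kappa>_le)
  then show "cosine_measure D > 0"
    using \<kappa>(1) by simp
  show "\<exists>d\<in>D. cosine_measure D * norm v \<le> v \<bullet> d"
  proof (cases "v = 0")
    case True
    then show ?thesis
      using ne by auto
  next
    case False
    have "cosine_measure D \<le> F v"
      unfolding cosine_measure_def F_def[symmetric] using False
      by (intro cINF_lower bdd_belowI2[of _ \<kappa>]) (auto intro: \<kappa>_le)
    moreover have "F v \<in> (\<lambda>d. (v \<bullet> d) / (norm v * norm d)) ` D"
      unfolding F_def using fin ne by (intro Max_in) auto
    ultimately obtain d where d: "d \<in> D" "cosine_measure D \<le> (v \<bullet> d) / (norm v * norm d)"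
      by auto
    then have "cosine_measure D * norm v \<le> v \<bullet> d"
      using False unit[OF d(1)] by (simp add: pos_le_divide_eq)
    then show ?thesis
      using d(1) by blast
  qed
qed

section \<open>Smooth and convex functions\<close>

text \<open>The chain rule that reduces the next two inequalities to functions of one real
  variable.\<close>

lemma GDERIV_along_line:
  assumes "GDERIV f (y + t *\<^sub>R h) :> g"
  shows "((\<lambda>t. f (y + t *\<^sub>R h)) has_real_derivative (h \<bullet> g)) (at t)"
proof -
  have "((\<lambda>t. y + t *\<^sub>R h) has_derivative (\<lambda>s. s *\<^sub>R h)) (at t)"
    by (auto intro!: derivative_eq_intros)
  moreover have "(f has_derivative (\<lambda>k. k \<bullet> g)) (at (y + t *\<^sub>R h))"
    using assms by (simp add: gderiv_def)
  ultimately have "((\<lambda>t. f (y + t *\<^sub>R h)) has_derivative (\<lambda>s. (s *\<^sub>R h) \<bullet> g)) (at t)"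
    by (rule has_derivative_compose)
  then show ?thesis
    by (simp add: has_field_derivative_def mult.commute[of _ "h \<bullet> g"])
qed

text \<open>The descent lemma, without integrating the gradient: subtracting the linear and
  quadratic terms along the segment leaves \<open>\<psi>\<close>, whose slope on [0, 1] is
  nonpositive by Cauchy-Schwarz and the Lipschitz bound.\<close>

lemma lipschitz_gradient_upper_bound:
  fixes f :: "'a::real_inner \<Rightarrow> real"
  assumes gradient: "\<And>y. GDERIV f y :> grad y" and lipschitz: "L-lipschitz_on UNIV grad"
  shows "f (y + h) \<le> f y + grad y \<bullet> h + L / 2 * (norm h)\<^sup>2"
proof -
  define \<psi> where "\<psi> t = f (y + t *\<^sub>R h) - t * (grad y \<bullet> h) - L / 2 * (norm h)\<^sup>2 * t\<^sup>2" for t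
  have "\<psi> 1 \<le> \<psi> 0"
  proof (rule DERIV_nonpos_imp_nonincreasing[of 0 1 \<psi>])
    fix t :: real
    assume t: "0 \<le> t" "t \<le> 1"
    let ?D = "h \<bullet> grad (y + t *\<^sub>R h) - grad y \<bullet> h - L * (norm h)\<^sup>2 * t"
    have "(\<psi> has_real_derivative ?D) (at t)"
      unfolding \<psi>_def
      by (auto intro!: derivative_eq_intros GDERIV_along_line[OF gradient])
    moreover have "?D \<le> 0"
    proof -
      have "h \<bullet> grad (y + t *\<^sub>R h) - grad y \<bullet> h = (grad (y + t *\<^sub>R h) - grad y) \<bullet> h"
        by (simp add: inner_diff inner_commute)
      also have "\<dots> \<le> norm (grad (y + t *\<^sub>R h) - grad y) * norm h"
        by (rule norm_cauchy_schwarz)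
      also have "\<dots> \<le> (L * norm (t *\<^sub>R h)) * norm h"
        using lipschitz_onD[OF lipschitz, of "y + t *\<^sub>R h" y]
        by (intro mult_right_mono) (auto simp: dist_norm)
      also have "\<dots> = L * (norm h)\<^sup>2 * t"
        using t by (simp add: power2_eq_square)
      finally show ?thesis
        by simp
    qed
    ultimately show "\<exists>D. DERIV \<psi> t :> D \<and> D \<le> 0"
      by blast
  qed simp
  then show ?thesis
    by (simp add: \<psi>_def)
qed

text \<open>Restriction to the line through \<open>y\<close> and \<open>z\<close> preserves
  convexity, so this is the one-dimensional tangent inequality at 0, read at 1.\<close>

lemma convex_gradient_lower_bound:
  fixes f :: "'a::real_inner \<Rightarrow> real"
  assumes convex: "convex_on UNIV f" and gradient: "GDERIV f y :> g"
  shows "f y + g \<bullet> (z - y) \<le> f z"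
proof -
  let ?\<phi> = "\<lambda>t. f (y + t *\<^sub>R (z - y))"
  have "convex_on UNIV ?\<phi>"
  proof (rule convex_onI)
    fix t u v :: real
    assume "0 < t" "t < 1"
    moreover have "y + ((1 - t) *\<^sub>R u + t *\<^sub>R v) *\<^sub>R (z - y)
        = (1 - t) *\<^sub>R (y + u *\<^sub>R (z - y)) + t *\<^sub>R (y + v *\<^sub>R (z - y))"
      by (simp add: algebra_simps)
    ultimately show "?\<phi> ((1 - t) *\<^sub>R u + t *\<^sub>R v) \<le> (1 - t) * ?\<phi> u + t * ?\<phi> v"
      using convex_onD[OF convex] by simp
  qed simp
  moreover have "(?\<phi> has_real_derivative ((z - y) \<bullet> g)) (at 0 within UNIV)"
    using GDERIV_along_line[of f y 0 "z - y" g] gradient by simp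
  ultimately have "?\<phi> 1 - ?\<phi> 0 \<ge> (z - y) \<bullet> g * (1 - 0)"
    by (intro convex_on_imp_above_tangent[where A = UNIV]) auto
  then show ?thesis
    by (simp add: inner_commute)
qed

section \<open>Simplified Direct Search\<close>

lemma sds_stepsize_eq: "sds_stepsize \<alpha>0 k = \<alpha>0 / 2 ^ k"
  by (induction k) auto

lemma poll_fails_gradient_bound:
  fixes f :: "'a::euclidean_space \<Rightarrow> real"
  assumes gradient: "\<And>y. GDERIV f y :> grad y" and lipschitz: "L-lipschitz_on UNIV grad"
    and unit: "\<And>d. d \<in> D \<Longrightarrow> norm d = 1" and span: "positive_spanning_set D"
    and "\<alpha> > 0" and fails: "poll_fails f D c \<alpha> y"
  shows "norm (grad y) \<le> (L / 2 + c) * \<alpha> / cosine_measure D"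
proof -
  \<comment> \<open>The alignment bound also holds for the zero vector, so a vanishing gradient
    needs no separate case.\<close>
  obtain d where d: "d \<in> D" "cosine_measure D * norm (- grad y) \<le> - grad y \<bullet> d"
    using cosine_measure_unit_pos(2)[OF span unit] by blast
  have "f y - c * \<alpha>\<^sup>2 < f (y + \<alpha> *\<^sub>R d)"
    using fails d(1) by (auto simp: poll_fails_def sufficient_decrease_def)
  also have "\<dots> \<le> f y + \<alpha> * (grad y \<bullet> d) + L / 2 * \<alpha>\<^sup>2"
    using lipschitz_gradient_upper_bound[OF gradient lipschitz, of y "\<alpha> *\<^sub>R d"] unit[OF d(1)]
    by simp
  \<comment> \<open>\<open>f y\<close> cancels, and one factor \<open>\<alpha>\<close> remains to be
    divided out.\<close>
  finally have "\<alpha> * (- grad y \<bullet> d) < \<alpha> * ((L / 2 + c) * \<alpha>)"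
    by (simp add: power2_eq_square algebra_simps)
  then have "- grad y \<bullet> d < (L / 2 + c) * \<alpha>"
    using \<open>\<alpha> > 0\<close> by (simp only: mult_less_cancel_left_pos)
  then have "cosine_measure D * norm (grad y) \<le> (L / 2 + c) * \<alpha>"
    using d(2) by simp
  then show ?thesis
    using cosine_measure_unit_pos(1)[OF span unit] by (simp add: field_simps)
qed

text \<open>Polls are assumed successful only before index \<open>l\<close>, which fits both uses:
  every \<open>l\<close> if the loop never stops, and the least failing index if it does.\<close>

lemma sds_inner_decrease:
  assumes exec: "sds_execution f D x0 \<alpha>0 c x X d" and "k \<ge> 1"
    and "\<And>i. i < l \<Longrightarrow> \<not> poll_fails f D c (sds_stepsize \<alpha>0 k) (X k i)"
  shows "f (X k l) \<le> f (x (k - 1)) - real l * (c * (sds_stepsize \<alpha>0 k)\<^sup>2)"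
  using assms(3)
proof (induction l)
  case 0
  then show ?case
    using exec \<open>k \<ge> 1\<close> by (simp add: sds_execution_def)
next
  case (Suc l)
  have "\<forall>i\<le>l. \<not> poll_fails f D c (sds_stepsize \<alpha>0 k) (X k i)"
    using Suc.prems by auto
  then have "sufficient_decrease f c (sds_stepsize \<alpha>0 k) (X k l) (d k l)"
      and "X k (Suc l) = X k l + sds_stepsize \<alpha>0 k *\<^sub>R d k l"
    using exec \<open>k \<ge> 1\<close> unfolding sds_execution_def by blast+
  then have "f (X k (Suc l)) \<le> f (X k l) - c * (sds_stepsize \<alpha>0 k)\<^sup>2"
    by (simp add: sufficient_decrease_def)
  then show ?case
    using Suc by (simp add: distrib_right)
qed

text \<open>An endless loop would lose the same positive amount at every step and, by the
  Archimedean property, fall below \<open>m\<close>.\<close>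

lemma sds_inner_stops_if_bounded_below:
  assumes exec: "sds_execution f D x0 \<alpha>0 c x X d" and "k \<ge> 1"
    and "\<alpha>0 > 0" "c > 0" and below: "\<And>y. m \<le> f y"
  shows "sds_inner_stops f D \<alpha>0 c X k"
proof (rule ccontr)
  assume "\<not> sds_inner_stops f D \<alpha>0 c X k"
  then have *: "f (X k l) \<le> f (x (k - 1)) - real l * (c * (sds_stepsize \<alpha>0 k)\<^sup>2)" for l
    using sds_inner_decrease[OF exec \<open>k \<ge> 1\<close>] by (auto simp: sds_inner_stops_def)
  have "c * (sds_stepsize \<alpha>0 k)\<^sup>2 > 0"
    using \<open>\<alpha>0 > 0\<close> \<open>c > 0\<close> by (simp add: sds_stepsize_eq)
  then obtain l where "f (x (k - 1)) - m < real l * (c * (sds_stepsize \<alpha>0 k)\<^sup>2)"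
    using ex_less_of_nat_mult by blast
  then show False
    using *[of l] below[of "X k l"] by linarith
qed

text \<open>Both sides of \<open>LEAST\<close> are used: the index found has a failed poll because
  the loop stops, and minimality makes all earlier polls successful.\<close>

lemma sds_iterate:
  assumes exec: "sds_execution f D x0 \<alpha>0 c x X d" and "k \<ge> 1"
    and stops: "sds_inner_stops f D \<alpha>0 c X k"
  shows "poll_fails f D c (sds_stepsize \<alpha>0 k) (x k)"
    and "f (x k) \<le> f (x (k - 1)) - real (sds_steps f D \<alpha>0 c X k) * (c * (sds_stepsize \<alpha>0 k)\<^sup>2)"
proof -
  have x: "x k = X k (sds_steps f D \<alpha>0 c X k)"
    using exec \<open>k \<ge> 1\<close> by (simp add: sds_execution_def)
  show "poll_fails f D c (sds_stepsize \<alpha>0 k) (x k)"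
    unfolding x sds_steps_def using stops unfolding sds_inner_stops_def by (rule LeastI_ex)
  show "f (x k) \<le> f (x (k - 1)) - real (sds_steps f D \<alpha>0 c X k) * (c * (sds_stepsize \<alpha>0 k)\<^sup>2)"
    unfolding x
    by (rule sds_inner_decrease[OF exec \<open>k \<ge> 1\<close>]) (unfold sds_steps_def, erule not_less_Least)
qed

section \<open>Evaluation counts, geometric sums and rounding\<close>

lemma sds_iteration_evals_le:
  assumes "sds_poll_costs f D \<alpha>0 c X q" "k \<ge> 1"
  shows "sds_iteration_evals f D \<alpha>0 c X q k \<le> card D * (sds_steps f D \<alpha>0 c X k + 1)"
proof -
  have "sds_iteration_evals f D \<alpha>0 c X q k \<le> (\<Sum>l\<le>sds_steps f D \<alpha>0 c X k. card D)"
    unfolding sds_iteration_evals_def using assms by (intro sum_mono) (auto simp: sds_poll_costs_def)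
  then show ?thesis
    by (simp add: mult.commute)
qed

lemma sds_total_evals_le_N:
  assumes "sds_poll_costs f D \<alpha>0 c X q"
  shows "sds_total_evals f D \<alpha>0 c X q k \<le> sds_N f D \<alpha>0 c X k"
  unfolding sds_total_evals_def sds_N_def
  using sds_iteration_evals_le[OF assms] by (intro add_left_mono sum_mono) auto

lemma sum_two_power_Suc: "(\<Sum>j=1..k. 2 ^ (j + 1)) = (2 ^ (k + 2) - 4 :: real)"
  by (induction k) auto

text \<open>Here \<open>K\<close> stands for \<open>B / (c * \<alpha>0)\<close>. The step bounds
  double with each iteration, so their sum is at most twice the last one.\<close>

lemma sds_N_le:
  assumes steps: "\<And>j. 1 \<le> j \<Longrightarrow> real (sds_steps f D \<alpha>0 c X j) \<le> 2 ^ (j + 1) * K" and "K \<ge> 0"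
  shows "real (sds_N f D \<alpha>0 c X k) \<le> 1 + real (card D) * (real k + 2 ^ (k + 2) * K)"
proof -
  have "(\<Sum>j=1..k. real (sds_steps f D \<alpha>0 c X j)) \<le> (\<Sum>j=1..k. 2 ^ (j + 1) * K)"
    using steps by (intro sum_mono) auto
  also have "\<dots> = (2 ^ (k + 2) - 4) * K"
    by (simp only: sum_distrib_right[symmetric] sum_two_power_Suc)
  also have "\<dots> \<le> 2 ^ (k + 2) * K"
    using \<open>K \<ge> 0\<close> by (intro mult_right_mono) auto
  \<comment> \<open>The summand 1 is the failed poll that ends each iteration; it yields the linear
    term in \<open>k\<close>.\<close>
  finally have "(\<Sum>j=1..k. 1 + real (sds_steps f D \<alpha>0 c X j)) \<le> real k + 2 ^ (k + 2) * K"
    by (simp add: sum.distrib)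
  from mult_left_mono[OF this, of "real (card D)"] show ?thesis
    by (simp add: sds_N_def sum_distrib_left distrib_left)
qed

text \<open>Rounding the exponent up costs at most a factor 2. The first bound gives the accuracy,
  the second turns \<open>2 ^ k\<close> into a multiple of \<open>1 / \<epsilon>\<close>.\<close>

lemma two_power_ceiling_log:
  fixes r :: real
  assumes "r \<ge> 1"
  shows "r \<le> 2 ^ nat \<lceil>log 2 r\<rceil>" and "2 ^ nat \<lceil>log 2 r\<rceil> \<le> 2 * r"
proof -
  let ?k = "nat \<lceil>log 2 r\<rceil>"
  \<comment> \<open>Nonnegativity keeps \<open>nat\<close> from truncating the ceiling.\<close>
  have "0 \<le> log 2 r"
    using assms by simp
  then have k: "log 2 r \<le> real ?k" "real ?k \<le> log 2 r + 1"
    by linarith+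
  have pow: "(2::real) ^ ?k = 2 powr real ?k"
    by (simp add: powr_realpow)
  have "2 powr log 2 r \<le> 2 powr real ?k"
    using k(1) by (rule powr_mono) simp
  then show "r \<le> 2 ^ ?k"
    unfolding pow using assms by simp
  have "2 powr real ?k \<le> 2 powr (log 2 r + 1)"
    using k(2) by (rule powr_mono) simp
  then show "2 ^ ?k \<le> 2 * r"
    unfolding pow using assms by (simp add: powr_add)
qed

theorem theorem12:
  fixes f :: "real ^ 'n \<Rightarrow> real"
    and grad :: "real ^ 'n \<Rightarrow> real ^ 'n"
    and D :: "(real ^ 'n) set"
    and x0 x_star :: "real ^ 'n"
    and L \<mu> \<alpha>0 c R0 B :: real
    and x :: "nat \<Rightarrow> real ^ 'n"
    and X d :: "nat \<Rightarrow> nat \<Rightarrow> real ^ 'n"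
    and q :: "nat \<Rightarrow> nat \<Rightarrow> nat"
  assumes convex: "convex_on UNIV f"
    and gradient: "\<And>y. GDERIV f y :> grad y"
    and L_pos: "L > 0"
    and lipschitz: "L-lipschitz_on UNIV grad"
    and minimizer: "\<And>y. f x_star \<le> f y"
    and unit_D: "\<And>d'. d' \<in> D \<Longrightarrow> norm d' = 1"
    and spanning_D: "positive_spanning_set D"
    and mu: "\<mu> = cosine_measure D"
    and alpha0_pos: "\<alpha>0 > 0"
    and c_pos: "c > 0"
    and R0_finite: "bdd_above {norm (y - x_star) | y. f y \<le> f x0}"
    and R0: "R0 = Sup {norm (y - x_star) | y. f y \<le> f x0}"
    and initial: "\<And>d'. d' \<in> D \<Longrightarrow> f (x0 + \<alpha>0 *\<^sub>R d') > f x0 - c * \<alpha>0\<^sup>2"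
    and B: "B = R0 * (L / 2 + c) / \<mu>"
    and execution: "sds_execution f D x0 \<alpha>0 c x X d"
    and costs: "sds_poll_costs f D \<alpha>0 c X q"
  shows
    "(\<forall>k\<ge>1. sds_inner_stops f D \<alpha>0 c X k) \<and>
     (\<forall>k. norm (grad (x k)) \<le> (L / 2 + c) * \<alpha>0 / (\<mu> * 2 ^ k) \<and>
          f (x k) - f x_star \<le> B * \<alpha>0 / 2 ^ k) \<and>
     (\<forall>k\<ge>1. sds_iteration_evals f D \<alpha>0 c X q k \<le> card D * (sds_steps f D \<alpha>0 c X k + 1) \<and>
          real (card D * (sds_steps f D \<alpha>0 c X k + 1))
            \<le> real (card D) * (1 + 2 ^ (k + 1) * B / (c * \<alpha>0))) \<and>
     (\<forall>\<epsilon> k. 0 < \<epsilon> \<and> \<epsilon> \<le> B * \<alpha>0 \<and> k = nat \<lceil>log 2 (B * \<alpha>0 / \<epsilon>)\<rceil> \<longrightarrow>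
          f (x k) - f x_star \<le> \<epsilon> \<and>
          sds_total_evals f D \<alpha>0 c X q k \<le> sds_N f D \<alpha>0 c X k \<and>
          real (sds_N f D \<alpha>0 c X k)
            \<le> 1 + real (card D) * (real k + 8 * B\<^sup>2 / (c * \<epsilon>)))"
proof -
  have mu_pos: "\<mu> > 0"
    unfolding mu using spanning_D unit_D by (rule cosine_measure_unit_pos(1))
  have dist_le: "norm (y - x_star) \<le> R0" if "f y \<le> f x0" for y
    unfolding R0 using that R0_finite by (intro cSup_upper) auto
  \<comment> \<open>The minimizer itself lies in the level set.\<close>
  have R0_nonneg: "R0 \<ge> 0"
    using dist_le[OF minimizer] by simp
  have B_nonneg: "B \<ge> 0"
    unfolding B using R0_nonneg L_pos c_pos mu_pos by simp
  have stops: "sds_inner_stops f D \<alpha>0 c X k" if "k \<ge> 1" for k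
    using sds_inner_stops_if_bounded_below[OF execution that alpha0_pos c_pos minimizer] .
  note iterate = sds_iterate[OF execution _ stops]
  have x_0: "x 0 = x0"
    using execution by (simp add: sds_execution_def)
  \<comment> \<open>All iterates stay in the initial level set, so \<open>R0\<close> bounds their
    distance to \<open>x_star\<close>.\<close>
  have below: "f (x k) \<le> f x0" for k
  proof (induction k)
    case (Suc k)
    have "0 \<le> real (sds_steps f D \<alpha>0 c X (Suc k)) * (c * (sds_stepsize \<alpha>0 (Suc k))\<^sup>2)"
      using c_pos by simp
    with Suc iterate(2)[of "Suc k"] show ?case
      by simp
  qed (simp add: x_0)
  \<comment> \<open>For \<open>k = 0\<close> the assumption on \<open>\<alpha>0\<close> takes the
    place of the failed poll that ends a later iteration.\<close>
  have fails: "poll_fails f D c (\<alpha>0 / 2 ^ k) (x k)" for k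
  proof (cases k)
    case 0
    then show ?thesis
      using initial by (auto simp: x_0 poll_fails_def sufficient_decrease_def not_le)
  next
    case (Suc j)
    then show ?thesis
      using iterate(1)[of k] by (simp add: sds_stepsize_eq)
  qed
  have grad_le: "norm (grad (x k)) \<le> (L / 2 + c) * \<alpha>0 / (\<mu> * 2 ^ k)" for k
    using poll_fails_gradient_bound[OF gradient lipschitz unit_D spanning_D _ fails, of k] alpha0_pos
    by (simp add: mu mult.commute)
  have gap_le: "f (x k) - f x_star \<le> B * \<alpha>0 / 2 ^ k" for k
  proof -
    have "f (x k) - f x_star \<le> grad (x k) \<bullet> (x k - x_star)"
      using convex_gradient_lower_bound[OF convex gradient, of "x k" x_star]
      by (simp add: inner_diff_right)
    also have "\<dots> \<le> norm (grad (x k)) * norm (x k - x_star)"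
      by (rule norm_cauchy_schwarz)
    also have "\<dots> \<le> (L / 2 + c) * \<alpha>0 / (\<mu> * 2 ^ k) * R0"
      using L_pos c_pos alpha0_pos mu_pos
      by (intro mult_mono grad_le dist_le below) auto
    also have "\<dots> = B * \<alpha>0 / 2 ^ k"
      by (simp add: B)
    finally show ?thesis .
  qed
  have steps_le: "real (sds_steps f D \<alpha>0 c X k) \<le> 2 ^ (k + 1) * (B / (c * \<alpha>0))" if k_pos: "k \<ge> 1" for k
  proof -
    let ?l = "real (sds_steps f D \<alpha>0 c X k)"
    \<comment> \<open>Iteration \<open>k\<close> starts at \<open>x j\<close> with
      \<open>j = k - 1\<close>, where the gap bound is twice that for index \<open>k\<close>; hence
      the exponent \<open>k + 1\<close>.\<close>
    obtain j where k: "k = Suc j"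
      using k_pos by (cases k) auto
    have "?l * (c * (\<alpha>0 / 2 ^ k)\<^sup>2) \<le> B * \<alpha>0 / 2 ^ j"
      using iterate(2)[OF k_pos] minimizer[of "x k"] gap_le[of j] by (simp add: k sds_stepsize_eq)
    also have "\<dots> = 2 ^ (k + 1) * (B / (c * \<alpha>0)) * (c * (\<alpha>0 / 2 ^ k)\<^sup>2)"
      using alpha0_pos c_pos by (simp add: k field_simps power2_eq_square)
    finally show ?thesis
      using alpha0_pos c_pos by (simp only: mult_le_cancel_right) (auto simp: zero_less_mult_iff)
  qed
  have iteration_le: "real (card D * (sds_steps f D \<alpha>0 c X k + 1))
      \<le> real (card D) * (1 + 2 ^ (k + 1) * B / (c * \<alpha>0))" if "k \<ge> 1" for k
    unfolding of_nat_mult using steps_le[OF that] by (intro mult_left_mono) auto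
  have total: "f (x k) - f x_star \<le> \<epsilon> \<and>
      real (sds_N f D \<alpha>0 c X k) \<le> 1 + real (card D) * (real k + 8 * B\<^sup>2 / (c * \<epsilon>))"
    if eps: "0 < \<epsilon>" "\<epsilon> \<le> B * \<alpha>0" and k: "k = nat \<lceil>log 2 (B * \<alpha>0 / \<epsilon>)\<rceil>" for \<epsilon> k
  proof
    \<comment> \<open>The upper bound on \<open>\<epsilon>\<close> is what makes the rounding lemma
      applicable.\<close>
    have "B * \<alpha>0 / \<epsilon> \<ge> 1"
      using eps by simp
    from two_power_ceiling_log[OF this, folded k]
    have pow: "B * \<alpha>0 / \<epsilon> \<le> 2 ^ k" "2 ^ k \<le> 2 * (B * \<alpha>0 / \<epsilon>)" .
    have "B * \<alpha>0 / 2 ^ k \<le> \<epsilon>"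
      using pow(1) eps by (simp add: field_simps)
    then show "f (x k) - f x_star \<le> \<epsilon>"
      using gap_le[of k] by linarith
    have K_nonneg: "0 \<le> B / (c * \<alpha>0)"
      using B_nonneg c_pos alpha0_pos by simp
    \<comment> \<open>The constant 8 is 4 from the geometric sum times 2 from rounding up the
      logarithm; \<open>\<alpha>0\<close> cancels.\<close>
    have "2 ^ (k + 2) * (B / (c * \<alpha>0)) \<le> 4 * (2 * (B * \<alpha>0 / \<epsilon>)) * (B / (c * \<alpha>0))"
      using pow(2) K_nonneg by (intro mult_right_mono) auto
    also have "\<dots> = 8 * B\<^sup>2 / (c * \<epsilon>)"
      using alpha0_pos by (simp add: power2_eq_square)
    finally have "real (card D) * (real k + 2 ^ (k + 2) * (B / (c * \<alpha>0)))
        \<le> real (card D) * (real k + 8 * B\<^sup>2 / (c * \<epsilon>))"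
      by (intro mult_left_mono) auto
    with sds_N_le[OF steps_le K_nonneg, of k]
    show "real (sds_N f D \<alpha>0 c X k) \<le> 1 + real (card D) * (real k + 8 * B\<^sup>2 / (c * \<epsilon>))"
      by linarith
  qed
  show ?thesis
    using stops grad_le gap_le sds_iteration_evals_le[OF costs] iteration_le total
      sds_total_evals_le_N[OF costs]
    by blast
qed

end
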